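(* Let $d$ be a positive integer and let $B_d$ be the $(3d+1)\times(d+1)$ matrix, with rows indexed by $r=0,1,\ldots,3d$ and columns indexed by $k=0,1,\ldots,d$, whose $(r,k)$th entry equals $$\sum_{j=0}^{k}\sum_{\ell=0}^{3d-3j}\binom{k}{j}\binom{3d-3j}{\ell}\binom{3j}{r-\ell}2^{\ell}(-1)^{3j+\ell-r}.$$ Suppose that $f(q)\in\mathfrak{O}_d(a^3,c^3)$ with $$f(q)=\sum_{n=0}^{\infty}v_nq^n=\sum_{k=0}^{d}\alpha_k\,a^{3(d-k)}(q)\,c^{3k}(q),\qquad \alpha_k\in\mathbb{C},$$ and let $$B_d(\alpha_0,\alpha_1,\ldots,\alpha_d)^T=(\beta_0,\beta_1,\ldots,\beta_{3d})^T.$$ Then, for $m=0,1,2$, $$\Omega_{3,m}(f)=\sum_{n=0}^{\infty}v_{3n+m}q^n=q^{-m/3}\sum_{k=0}^{d-\mathbf{1}(m)}\beta_{3k+m}\,a^{3d-3k-m}(q)\,c^{3k+m}(q),$$ where $\mathbf{1}$ denotes the principal Dirichlet character modulo three.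
   Context: Let $q=e^{2\pi i\tau}$ with $\operatorname{Im}\tau>0$, and $q^{s}=e^{2\pi i s\tau}$ for rational $s$. The Borweins' cubic theta functions $a$ and $c$ are $$a(q)=\sum_{m,n=-\infty}^{\infty}q^{n^2+nm+m^2},\qquad c(q)=\sum_{m,n=-\infty}^{\infty} q^{(n+\frac13)^2+(n+\frac13)(m+\frac13)+(m+\frac13)^2}.$$ $\mathfrak{O}_d(x,y)$ denotes the complex span of homogeneous polynomials in $x$ and $y$ of degree $d$; here $x=a^3=a(q)^3$, $y=c^3=c(q)^3$. The dissection operators are $\Omega_{3,m}\bigl(\sum_{n\ge0}\nu_nq^n\bigr)=\sum_{n\ge0}\nu_{3n+m}q^n$ for $m=0,1,2$. The principal character satisfies $\mathbf{1}(0)=0$ and $\mathbf{1}(1)=\mathbf{1}(2)=1$. Binomial coefficients $\binom{N}{i}$ are $0$ when $i<0$ or $i>N$. *)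

theory Defs
  imports "HOL-Complex_Analysis.Complex_Analysis" "Jordan_Normal_Form.Matrix"
begin

text \<open>
  Functions of $q$ are represented as functions of \<open>\<tau>\<close>, with \<open>Im \<tau> > 0\<close>, so that
  the fractional power $q^s$ is unambiguous.
\<close>

definition qpow :: "complex \<Rightarrow> rat \<Rightarrow> complex" where
  "qpow \<tau> s = exp (2 * of_real pi * \<i> * of_rat s * \<tau>)"

definition borwein_a :: "complex \<Rightarrow> complex" where
  "borwein_a \<tau> = (\<Sum>\<^sub>\<infinity>(m, n)\<in>(UNIV :: (int \<times> int) set).
     qpow \<tau> (of_int (n^2 + n * m + m^2)))"

definition borwein_c :: "complex \<Rightarrow> complex" where
  "borwein_c \<tau> = (\<Sum>\<^sub>\<infinity>(m, n)\<in>(UNIV :: (int \<times> int) set).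
     qpow \<tau> ((of_int n + 1/3)^2 + (of_int n + 1/3) * (of_int m + 1/3) + (of_int m + 1/3)^2))"

text \<open>
  Functions are identified when they agree on the upper half-plane; values elsewhere are junk.
\<close>

definition homog_span ::
    "nat \<Rightarrow> (complex \<Rightarrow> complex) \<Rightarrow> (complex \<Rightarrow> complex) \<Rightarrow> (complex \<Rightarrow> complex) set" where
  "homog_span d x y =
     {f. \<exists>p :: nat \<Rightarrow> complex. \<forall>\<tau>. Im \<tau> > 0 \<longrightarrow>
           f \<tau> = (\<Sum>k=0..d. p k * x \<tau> ^ (d - k) * y \<tau> ^ k)}"

definition has_q_expansion :: "(complex \<Rightarrow> complex) \<Rightarrow> (nat \<Rightarrow> complex) \<Rightarrow> bool" where
  "has_q_expansion f v \<longleftrightarrow>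
     (\<forall>\<tau>. Im \<tau> > 0 \<longrightarrow> (\<lambda>n. v n * qpow \<tau> (of_nat n)) sums f \<tau>)"

text \<open>
  The coefficients of a $q$-expansion are unique, see \<open>q_coeffs_eq\<close> below; for a function
  without a $q$-expansion the value is unspecified.
\<close>

definition q_coeffs :: "(complex \<Rightarrow> complex) \<Rightarrow> nat \<Rightarrow> complex" where
  "q_coeffs f = (THE v. has_q_expansion f v)"

definition dissect3 :: "nat \<Rightarrow> (complex \<Rightarrow> complex) \<Rightarrow> complex \<Rightarrow> complex" where
  "dissect3 m f \<tau> = (\<Sum>n. q_coeffs f (3 * n + m) * qpow \<tau> (of_nat n))"

definition principal_char3 :: "nat \<Rightarrow> nat" where
  "principal_char3 m = (if 3 dvd m then 0 else 1)"

text \<open>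
  The lower index of the last binomial coefficient in \<open>B_mat\<close> can be negative, in which case
  the coefficient is zero; truncated subtraction on \<^typ>\<open>nat\<close> would give the value 1 instead.
\<close>

definition zbinomial :: "nat \<Rightarrow> int \<Rightarrow> nat" where
  "zbinomial N i = (if i < 0 then 0 else N choose nat i)"

definition B_mat :: "nat \<Rightarrow> complex mat" where
  "B_mat d = Matrix.mat (3 * d + 1) (d + 1) (\<lambda>(r, k).
     \<Sum>j=0..k. \<Sum>l=0..3 * d - 3 * j.
       of_nat (k choose j) * of_nat ((3 * d - 3 * j) choose l)
       * of_nat (zbinomial (3 * j) (int r - int l))
       * 2 ^ l * (-1) powi (3 * int j + int l - int r))"

lemma has_q_expansion_unique:
  assumes "has_q_expansion f v" "has_q_expansion f w"
  shows "v = w"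
proof -
  define u where "u n = v n - w n" for n
  have u: "(\<lambda>n. u n * z ^ n) sums 0" if z: "norm z < 1" "z \<noteq> 0" for z
  proof -
    define \<tau> where "\<tau> = Ln z / (2 * of_real pi * \<i>)"
    have "Im \<tau> = - ln (norm z) / (2 * pi)"
      using z by (simp add: \<tau>_def Im_divide power2_eq_square)
    hence "Im \<tau> > 0"
      using z by (simp add: divide_neg_pos)
    moreover have "qpow \<tau> (of_nat n) = z ^ n" for n
    proof -
      have "qpow \<tau> (of_nat n) = exp (of_nat n * Ln z)"
        by (simp add: qpow_def \<tau>_def field_simps)
      thus ?thesis using z by (simp add: exp_of_nat_mult)
    qed
    ultimately have "(\<lambda>n. v n * z ^ n) sums f \<tau>" "(\<lambda>n. w n * z ^ n) sums f \<tau>"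
      using assms by (auto simp: has_q_expansion_def)
    from sums_diff[OF this] show ?thesis
      by (simp add: u_def algebra_simps)
  qed
  have "u n = 0" for n
  proof (rule ccontr)
    assume nz: "u n \<noteq> 0"
    define m where "m = (LEAST n. u n \<noteq> 0)"
    have m: "u m \<noteq> 0" "\<And>i. i < m \<Longrightarrow> u i = 0"
      using LeastI[of "\<lambda>n. u n \<noteq> 0", OF nz] not_less_Least[of _ "\<lambda>n. u n \<noteq> 0"]
      unfolding m_def by blast+
    define g where "g z = (\<Sum>n. u (n + m) * z ^ n)" for z
    have s: "(\<lambda>n. u (n + m) * z ^ n) sums 0" if z: "norm z < 1" "z \<noteq> 0" for z
    proof -
      have "(\<lambda>n. u (n + m) * z ^ (n + m)) sums (0 - (\<Sum>i<m. u i * z ^ i))"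
        using u[OF z] by (intro sums_split_initial_segment)
      hence "(\<lambda>n. z ^ m * (u (n + m) * z ^ n)) sums (z ^ m * 0)"
        using m(2) by (simp add: power_add mult_ac)
      thus ?thesis using z by (subst (asm) sums_mult_iff) auto
    qed
    have s1: "(\<lambda>n. u (n + m) * z ^ n) sums g z" if "norm z < 1" for z
    proof (cases "z = 0")
      case True
      have "summable (\<lambda>n. u (n + m) * 0 ^ n)" by (rule summable_finite[of "{0}"]) auto
      thus ?thesis using True by (simp add: g_def summable_sums)
    next
      case False
      thus ?thesis using s[of z] that by (simp add: g_def sums_iff)
    qed
    have "(g \<longlongrightarrow> u (0 + m)) (at 0)"
      by (rule powser_limit_0[of 1]) (use s1 in auto)
    moreover have "eventually (\<lambda>z. g z = 0) (at 0)"
      unfolding eventually_at using s by (intro exI[of _ 1]) (auto simp: g_def sums_iff)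
    hence "(g \<longlongrightarrow> 0) (at 0)" by (rule tendsto_eventually)
    ultimately have "u m = 0"
      using tendsto_unique[of "at (0::complex)"] by auto
    thus False using m by simp
  qed
  thus ?thesis by (auto simp: u_def)
qed

lemma q_coeffs_eq: "has_q_expansion f v \<Longrightarrow> q_coeffs f = v"
  unfolding q_coeffs_def by (rule the_equality) (auto intro: has_q_expansion_unique)

end

theory Submission
  imports Defs
begin

text \<open>
  Write $A(q) = a(q^3)$ and $C(q) = c(q^3)$. The whole theorem rests on two identities,
  \[ a(q) = A + 2 C, \qquad c(q)^3 = (A + 2 C)^3 - (A - C)^3, \]
  which turn a form in $a^3$ and $c^3$ into a form in $A$ and $C$. The entries of \<open>B_mat d\<close> are
  what the binomial theorem gives for the coefficients of that substitution
  (\<open>B_mat_change_of_basis\<close>), so $f = \sum_r \beta_r A^{3d-r} C^r$. Now $A$ is a power series in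
  $q^3$ and $C$ is $q$ times a power series in $q^3$. Hence the terms of $f$ whose exponent is
  congruent to $m$ modulo three are exactly those with $r$ congruent to $m$, and replacing $q^3$
  by $q$ turns $A$, $C$ back into $a$, $c$. Instead of multiplying power series, the proof extracts
  these terms by averaging over the translations of $\tau$ by thirds, under which $A$ is invariant
  and $C$ is multiplied by a cube root of unity (\<open>hex_theta_shift\<close>, \<open>sums_trisection\<close>).

  Both identities come from the arithmetic of the Eisenstein integers $Z[\omega]$, where $\omega$ is
  a primitive cube root of unity. There $a$ is the theta series of the ring and $A$, $C$ are the
  theta series of the residue classes of 0 and 1 modulo the prime $1 - \omega$ of norm three.
  The classes of 1 and -1 contribute equally, which gives the first identity. For the second one,
  $c(q)^3$ is a sum over triples $(u, v, w)$ of elements of the class of 1, with weight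
  $q^{(|u|^2+|v|^2+|w|^2)/3}$. Multiplying $w$ by $\omega$ permutes cyclically the three residues
  modulo three that $u + v + w$ can have, so it suffices to sum over the triples with $u + v + w$
  divisible by three and to multiply by three. On those triples the discrete Fourier transform
  \[ (x, y, z) \mapsto (x + y + z,\; x + \omega y + \omega^2 z,\; x + \omega^2 y + \omega z), \]
  which triples the total norm, can be inverted over $Z[\omega]$. It identifies them with the
  triples $(x, y, z)$ whose sum lies in the class of 1, and splitting the latter by residue classes
  gives $3 (A^2 C + A C^2 + C^3)$. Altogether $c(q)^3 = 9 (A^2 C + A C^2 + C^3)$, which is the second
  identity multiplied out (\<open>borwein_c_cubed\<close>).
\<close>

section \<open>Partial theta series of the hexagonal lattice\<close>

text \<open>
  The pair \<open>(m, n)\<close> stands for the Eisenstein integer $m - n\omega$, whose squared modulus is the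
  quadratic form of the cubic theta functions.
\<close>

definition hex_norm :: "int \<times> int \<Rightarrow> int" where
  "hex_norm = (\<lambda>(m, n). m^2 + m * n + n^2)"

definition hex_term :: "complex \<Rightarrow> int \<times> int \<Rightarrow> complex" where
  "hex_term \<tau> p = exp (2 * of_real pi * \<i> * \<tau> * of_int (hex_norm p))"

definition hex_theta :: "complex \<Rightarrow> (int \<times> int) set \<Rightarrow> complex" where
  "hex_theta \<tau> S = infsum (hex_term \<tau>) S"

text \<open>
  The residue classes modulo $1 - \omega$: as $\omega$ is congruent to 1, the element $m - n\omega$
  is congruent to $m - n$.
\<close>

definition hex_class :: "int \<Rightarrow> (int \<times> int) set" where
  "hex_class i = {(m, n). (m - n) mod 3 = i}"

lemma hex_norm_lower_bound: "\<bar>m\<bar> + \<bar>n\<bar> \<le> 2 * hex_norm (m, n)"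
proof -
  have *: "\<bar>k\<bar> \<le> k^2" for k :: int
  proof (cases "k = 0")
    case False
    hence "\<bar>k\<bar> * 1 \<le> \<bar>k\<bar> * \<bar>k\<bar>" by (intro mult_left_mono) auto
    thus ?thesis by (simp add: power2_eq_square)
  qed auto
  have "2 * hex_norm (m, n) = (m + n)^2 + m^2 + n^2"
    by (simp add: hex_norm_def power2_eq_square algebra_simps)
  thus ?thesis using *[of m] *[of n] zero_le_power2[of "m + n"] by linarith
qed

lemma summable_on_times:
  fixes f :: "'a \<Rightarrow> complex" and g :: "'b \<Rightarrow> complex"
  assumes "f summable_on A" "g summable_on B"
  shows "(\<lambda>(x, y). f x * g y) summable_on A \<times> B"
proof -
  have f: "(\<lambda>x. norm (f x)) summable_on A" and g: "(\<lambda>x. norm (g x)) summable_on B"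
    using assms by (simp_all add: summable_on_iff_abs_summable_on_complex)
  have "(\<lambda>(x, y). norm (f x) * norm (g y)) summable_on A \<times> B"
  proof (rule summable_on_SigmaI)
    show "((\<lambda>y. case (x, y) of (x, y) \<Rightarrow> norm (f x) * norm (g y)) has_sum
            norm (f x) * infsum (\<lambda>y. norm (g y)) B) B" for x
      using has_sum_cmult_right[OF has_sum_infsum[OF g]] by simp
    show "(\<lambda>x. norm (f x) * infsum (\<lambda>y. norm (g y)) B) summable_on A"
      by (intro summable_on_cmult_left f)
  qed auto
  moreover have "(\<lambda>(x, y). norm (f x) * norm (g y)) = (\<lambda>p. norm ((\<lambda>(x, y). f x * g y) p))"
    by (auto simp: norm_mult)
  ultimately show ?thesis
    by (simp add: summable_on_iff_abs_summable_on_complex)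
qed

lemma infsum_times:
  fixes f :: "'a \<Rightarrow> complex" and g :: "'b \<Rightarrow> complex"
  assumes "f summable_on A" "g summable_on B"
  shows "infsum (\<lambda>(x, y). f x * g y) (A \<times> B) = infsum f A * infsum g B"
proof -
  have "infsum (\<lambda>(x, y). f x * g y) (A \<times> B) = infsum (\<lambda>x. infsum (\<lambda>y. f x * g y) B) A"
    using infsum_Sigma_banach[OF summable_on_times[OF assms]] by simp
  also have "\<dots> = infsum (\<lambda>x. f x * infsum g B) A"
    using assms by (intro infsum_cong infsum_cmult_right) auto
  also have "\<dots> = infsum f A * infsum g B"
    using assms by (intro infsum_cmult_left) auto
  finally show ?thesis .
qed

lemma summable_on_power_nat_abs:
  fixes r :: real
  assumes "0 \<le> r" "r < 1"
  shows "(\<lambda>k :: int. r ^ nat \<bar>k\<bar>) summable_on UNIV"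
proof -
  have geo: "(\<lambda>n :: nat. r ^ n) summable_on UNIV"
    using assms by (subst summable_on_UNIV_nonneg_real_iff) (auto intro: summable_geometric)
  have "(\<lambda>k :: int. r ^ nat \<bar>k\<bar>) summable_on range int"
    by (subst summable_on_reindex) (use geo in \<open>auto simp: o_def\<close>)
  moreover have "(\<lambda>k :: int. r ^ nat \<bar>k\<bar>) summable_on range (\<lambda>n. - int n)"
    by (subst summable_on_reindex) (use geo in \<open>auto simp: o_def inj_on_def\<close>)
  ultimately have "(\<lambda>k :: int. r ^ nat \<bar>k\<bar>) summable_on (range int \<union> range (\<lambda>n. - int n))"
    by (rule summable_on_union)
  also have "range int \<union> range (\<lambda>n. - int n) = UNIV"
  proof -
    have "k \<in> range int \<union> range (\<lambda>n. - int n)" for k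
      by (cases k rule: int_cases2) auto
    thus ?thesis by blast
  qed
  finally show ?thesis .
qed

text \<open>
  The form is bounded below by half of the sum of the absolute values of the coordinates, so the
  series is dominated by a product of two geometric series.
\<close>

lemma hex_term_summable:
  assumes "Im \<tau> > 0"
  shows "hex_term \<tau> summable_on S"
proof -
  define r where "r = exp (- pi * Im \<tau>)"
  have r: "0 \<le> r" "r < 1" using assms by (auto simp: r_def)
  have g: "(\<lambda>k :: int. complex_of_real (r ^ nat \<bar>k\<bar>)) summable_on UNIV"
    using summable_on_power_nat_abs[OF r]
    by (subst summable_on_iff_abs_summable_on_complex)
       (use r in \<open>simp add: norm_power\<close>)
  have "(\<lambda>(m, n). complex_of_real (r ^ nat \<bar>m\<bar>) * complex_of_real (r ^ nat \<bar>n\<bar>))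
          summable_on (UNIV \<times> UNIV :: (int \<times> int) set)"
    by (rule summable_on_times[OF g g])
  hence "(\<lambda>p. norm (case p of (m, n) \<Rightarrow> complex_of_real (r ^ nat \<bar>m\<bar>) * complex_of_real (r ^ nat \<bar>n\<bar>)))
          summable_on (UNIV :: (int \<times> int) set)"
    by (simp add: summable_on_iff_abs_summable_on_complex)
  hence "(\<lambda>p. norm (hex_term \<tau> p)) summable_on UNIV"
  proof (rule summable_on_comparison_test)
    fix p :: "int \<times> int"
    obtain m n where p: "p = (m, n)" by force
    have "norm (hex_term \<tau> p) = exp (- pi * Im \<tau> * of_int (2 * hex_norm p))"
      by (simp add: hex_term_def mult_ac)
    also have "\<dots> \<le> exp (- pi * Im \<tau> * of_int (\<bar>m\<bar> + \<bar>n\<bar>))"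
    proof -
      have "real_of_int (\<bar>m\<bar> + \<bar>n\<bar>) \<le> of_int (2 * hex_norm p)"
        using hex_norm_lower_bound[of m n] unfolding p of_int_le_iff .
      thus ?thesis using assms by (simp only: exp_le_cancel_iff) (intro mult_left_mono_neg, auto)
    qed
    also have "\<dots> = r ^ nat \<bar>m\<bar> * r ^ nat \<bar>n\<bar>"
      by (simp add: r_def exp_of_nat_mult [symmetric] exp_add [symmetric] algebra_simps)
    finally show "norm (hex_term \<tau> p) \<le>
        norm (case p of (m, n) \<Rightarrow> complex_of_real (r ^ nat \<bar>m\<bar>) * complex_of_real (r ^ nat \<bar>n\<bar>))"
      using r by (simp add: p norm_mult norm_power)
  qed auto
  hence "hex_term \<tau> summable_on UNIV"
    by (simp add: summable_on_iff_abs_summable_on_complex)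
  thus ?thesis by (rule summable_on_subset_banach) auto
qed

lemma borwein_a_eq_hex_theta: "borwein_a \<tau> = hex_theta \<tau> UNIV"
  unfolding borwein_a_def hex_theta_def
proof (rule infsum_cong)
  fix p :: "int \<times> int"
  obtain m n where p: "p = (m, n)" by force
  have "hex_norm p = n^2 + n * m + m^2"
    by (simp add: p hex_norm_def algebra_simps)
  thus "(case p of (m, n) \<Rightarrow> qpow \<tau> (of_int (n^2 + n * m + m^2))) = hex_term \<tau> p"
    by (simp only: p prod.case qpow_def hex_term_def of_rat_of_int_eq mult_ac)
qed

text \<open>
  Multiplication by $1 - \omega$ maps the whole ring onto the class of 0 and triples the norm.
\<close>

lemma borwein_a_triple: "borwein_a (3 * \<tau>) = hex_theta \<tau> (hex_class 0)"
proof -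
  define j :: "int \<times> int \<Rightarrow> int \<times> int" where "j = (\<lambda>(m, n). (m - n, m + 2 * n))"
  have inj: "inj j" by (auto simp: j_def inj_def)
  have img: "hex_class 0 = range j"
  proof (intro equalityI subsetI)
    fix p assume "p \<in> hex_class 0"
    then obtain x y where p: "p = (x, y)" "3 dvd (x - y)"
      by (auto simp: hex_class_def mod_eq_0_iff_dvd)
    then obtain k where "x - y = 3 * k" by auto
    hence "p = j (x - k, - k)" by (auto simp: p j_def)
    thus "p \<in> range j" by blast
  qed (auto simp: hex_class_def j_def mod_eq_0_iff_dvd)
  have "hex_term \<tau> (j p) = hex_term (3 * \<tau>) p" for p
  proof -
    have "hex_norm (j p) = 3 * hex_norm p"
      by (cases p) (simp add: j_def hex_norm_def power2_eq_square algebra_simps)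
    thus ?thesis by (simp add: hex_term_def mult_ac)
  qed
  hence "hex_theta \<tau> (hex_class 0) = hex_theta (3 * \<tau>) UNIV"
    unfolding img hex_theta_def by (simp add: infsum_reindex[OF inj] o_def)
  thus ?thesis by (simp add: borwein_a_eq_hex_theta)
qed

text \<open>
  The series $c$ runs over the translate of the lattice by the point (1/3, 1/3). Multiplication by
  the element $2 + \omega$ of norm three, after an exchange of the coordinates, sends that point
  to 1 and hence the translate onto the class of 1.
\<close>

lemma borwein_c_triple: "borwein_c (3 * \<tau>) = hex_theta \<tau> (hex_class 1)"
proof -
  define j :: "int \<times> int \<Rightarrow> int \<times> int" where "j = (\<lambda>(m, n). (m + 2 * n + 1, m - n))"
  have inj: "inj j" by (auto simp: j_def inj_def)
  have img: "hex_class 1 = range j"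
  proof (intro equalityI subsetI)
    fix p assume "p \<in> hex_class 1"
    then obtain x y where p: "p = (x, y)" "(x - y) mod 3 = 1"
      by (auto simp: hex_class_def)
    define k where "k = (x - y) div 3"
    have "x = y + 3 * k + 1" using p unfolding k_def by presburger
    hence "p = j (y + k, k)" by (auto simp: p j_def)
    thus "p \<in> range j" by blast
  next
    fix p assume "p \<in> range j"
    then obtain m n where "p = j (m, n)" by force
    hence "p = (m + 2 * n + 1, m - n)" by (simp add: j_def)
    moreover have "(m + 2 * n + 1 - (m - n)) mod 3 = 1" by presburger
    ultimately show "p \<in> hex_class 1" by (simp add: hex_class_def)
  qed
  (* The exponents are compared in the rationals, where qpow takes its exponent. *)
  have "hex_term \<tau> (j (m, n)) = qpow (3 * \<tau>)
          ((of_int n + 1/3)^2 + (of_int n + 1/3) * (of_int m + 1/3) + (of_int m + 1/3)^2)"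
    (is "_ = qpow _ ?s") for m n
  proof -
    have "rat_of_int (hex_norm (j (m, n))) = 3 * ?s"
      by (simp add: j_def hex_norm_def power2_eq_square algebra_simps)
    hence "of_rat (rat_of_int (hex_norm (j (m, n)))) = (of_rat (3 * ?s) :: complex)"
      by (rule arg_cong)
    hence "of_int (hex_norm (j (m, n))) = 3 * (of_rat ?s :: complex)"
      by (simp only: of_rat_of_int_eq of_rat_mult of_rat_numeral_eq)
    thus ?thesis by (simp only: hex_term_def qpow_def mult_ac)
  qed
  hence "hex_theta \<tau> (hex_class 1) = borwein_c (3 * \<tau>)"
    unfolding img hex_theta_def borwein_c_def
    by (subst infsum_reindex[OF inj]) (auto intro!: infsum_cong)
  thus ?thesis by simp
qed

lemma int_mod_3_cases: "a mod 3 = 0 \<or> a mod 3 = 1 \<or> a mod 3 = (2 :: int)"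
  using pos_mod_bound[of 3 a] pos_mod_sign[of 3 a] by linarith

lemma mod_3_eqI: "a = 3 * k + r \<Longrightarrow> 0 \<le> r \<Longrightarrow> r < 3 \<Longrightarrow> a mod 3 = (r :: int)"
  by simp

lemma mod_3_eqE:
  assumes "a mod 3 = (r :: int)"
  obtains k where "a = 3 * k + r"
  using mult_div_mod_eq[of 3 a] assms by metis

lemma hex_class_swap: "prod.swap p \<in> hex_class 1 \<longleftrightarrow> p \<in> hex_class 2"
proof -
  have "(- a) mod 3 = 1 \<longleftrightarrow> a mod 3 = 2" for a :: int
    by presburger
  from this[of "fst p - snd p"] show ?thesis
    by (cases p) (simp add: hex_class_def)
qed

text \<open>
  Exchanging the coordinates preserves the norm and negates the residue class.
\<close>

lemma hex_theta_class_2: "hex_theta \<tau> (hex_class 2) = hex_theta \<tau> (hex_class 1)"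
  unfolding hex_theta_def
proof (rule infsum_reindex_bij_witness[where i = prod.swap and j = prod.swap])
  show "prod.swap p \<in> hex_class 2" if "p \<in> hex_class 1" for p
    using that hex_class_swap[of "prod.swap p"] by simp
  show "hex_term \<tau> (prod.swap p) = hex_term \<tau> p" for p
    by (cases p) (simp add: hex_term_def hex_norm_def algebra_simps)
qed (simp_all add: hex_class_swap)

lemma hex_class_disjoint: "i \<noteq> j \<Longrightarrow> hex_class i \<inter> hex_class j = {}"
  by (auto simp: hex_class_def)

lemma UN_hex_class: "(\<Union>i\<in>{0, 1, 2}. hex_class i) = UNIV"
  using int_mod_3_cases by (auto simp: hex_class_def)

lemma borwein_a_eq:
  assumes "Im \<tau> > 0"
  shows "borwein_a \<tau> = hex_theta \<tau> (hex_class 0) + 2 * hex_theta \<tau> (hex_class 1)"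
proof -
  have "borwein_a \<tau> = infsum (hex_term \<tau>) (\<Union>i\<in>{0, 1, 2}. hex_class i)"
    by (simp only: UN_hex_class borwein_a_eq_hex_theta hex_theta_def)
  also have "\<dots> = (\<Sum>i\<in>{0, 1, 2}. hex_theta \<tau> (hex_class i))"
    unfolding hex_theta_def
    by (rule sum_infsum [symmetric]) (use hex_term_summable[OF assms] hex_class_disjoint in auto)
  finally show ?thesis by (simp add: hex_theta_class_2)
qed

section \<open>Triples of lattice points and the cubic identity\<close>

type_synonym hex_triple = "(int \<times> int) \<times> (int \<times> int) \<times> (int \<times> int)"

definition hex_triple_term :: "complex \<Rightarrow> hex_triple \<Rightarrow> complex" where
  "hex_triple_term \<tau> = (\<lambda>(x, y, z). hex_term \<tau> x * (hex_term \<tau> y * hex_term \<tau> z))"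

definition hex_triple_theta :: "complex \<Rightarrow> hex_triple set \<Rightarrow> complex" where
  "hex_triple_theta \<tau> S = infsum (hex_triple_term \<tau>) S"

lemma hex_triple_term_eq:
  "hex_triple_term \<tau> (x, y, z) =
     exp (2 * of_real pi * \<i> * \<tau> * of_int (hex_norm x + hex_norm y + hex_norm z))"
  by (simp add: hex_triple_term_def hex_term_def exp_add [symmetric] distrib_left add.assoc)

lemma hex_triple_term_split:
  "hex_triple_term \<tau> = (\<lambda>(x, p). hex_term \<tau> x * (\<lambda>(y, z). hex_term \<tau> y * hex_term \<tau> z) p)"
  by (auto simp: hex_triple_term_def)

lemma hex_triple_term_summable:
  assumes "Im \<tau> > 0"
  shows "hex_triple_term \<tau> summable_on S"
proof -
  note s = hex_term_summable[OF assms]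
  have "hex_triple_term \<tau> summable_on UNIV \<times> (UNIV \<times> UNIV)"
    unfolding hex_triple_term_split by (intro summable_on_times s)
  thus ?thesis by (rule summable_on_subset_banach) auto
qed

lemma hex_triple_theta_times:
  assumes "Im \<tau> > 0"
  shows "hex_triple_theta \<tau> (A \<times> B \<times> C) = hex_theta \<tau> A * hex_theta \<tau> B * hex_theta \<tau> C"
  unfolding hex_triple_theta_def hex_triple_term_split hex_theta_def
  by (simp add: infsum_times summable_on_times hex_term_summable[OF assms])

text \<open>
  The triples whose sum lies in the class of 1 modulo $1 - \omega$.
\<close>

definition hex_sum_one :: "hex_triple set" where
  "hex_sum_one = {((x1, x2), (y1, y2), (z1, z2)). (x1 + y1 + z1 - (x2 + y2 + z2)) mod 3 = 1}"

text \<open>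
  The triples of elements of the class of 1, sorted by the residue of their sum modulo three. The
  sum is an element $m - n\omega$ with $m$ congruent to $n$ modulo three, because $m - n$ is a sum of
  three numbers congruent to 1. Its residue modulo three is therefore determined by $m$.
\<close>

definition hex_unit_triples :: "int \<Rightarrow> hex_triple set" where
  "hex_unit_triples i = {((x1, x2), (y1, y2), (z1, z2)).
     (x1 - x2) mod 3 = 1 \<and> (y1 - y2) mod 3 = 1 \<and> (z1 - z2) mod 3 = 1 \<and> (x1 + y1 + z1) mod 3 = i}"

lemma hex_triple_cases:
  obtains x1 x2 y1 y2 z1 z2 where "p = (((x1, x2), (y1, y2), (z1, z2)) :: hex_triple)"
proof -
  obtain x y z where "p = (x, y, z)" by (rule prod_cases3)
  thus thesis by (cases x; cases y; cases z) (use that in blast)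
qed

text \<open>
  The classes of two components determine the class of the third one, so these triples split into
  nine products of residue classes.
\<close>

lemma hex_sum_one_iff:
  "p \<in> hex_sum_one \<longleftrightarrow>
     (\<exists>i\<in>{0, 1, 2}. \<exists>j\<in>{0, 1, 2}. p \<in> hex_class i \<times> hex_class j \<times> hex_class ((1 - i - j) mod 3))"
proof (cases p rule: hex_triple_cases)
  case (1 x1 x2 y1 y2 z1 z2)
  define a b c where "a = x1 - x2" and "b = y1 - y2" and "c = z1 - z2"
  define I where "I = {0, 1, 2 :: int}"
  have I: "a mod 3 \<in> I" "b mod 3 \<in> I"
    using int_mod_3_cases[of a] int_mod_3_cases[of b] by (simp_all add: I_def)
  have mod_iff: "(a + b + c) mod 3 = 1 \<longleftrightarrow> c mod 3 = (1 - a mod 3 - b mod 3) mod 3"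
  proof -
    have "(a + b + c) mod 3 = 1 mod 3 \<longleftrightarrow> 3 dvd (a + b + c - 1)"
      by (rule mod_eq_dvd_iff)
    also have "a + b + c - 1 = c - (1 - a - b)" by simp
    also have "3 dvd \<dots> \<longleftrightarrow> c mod 3 = (1 - a - b) mod 3"
      by (rule mod_eq_dvd_iff [symmetric])
    also have "(1 - a - b) mod 3 = (1 - a mod 3 - b mod 3) mod 3"
      by (rule mod_diff_cong, rule mod_diff_cong) simp_all
    finally show ?thesis by simp
  qed
  have "p \<in> hex_sum_one \<longleftrightarrow> (a + b + c) mod 3 = 1"
    by (simp add: 1 hex_sum_one_def a_def b_def c_def algebra_simps)
  also have "\<dots> \<longleftrightarrow> (\<exists>i\<in>I. \<exists>j\<in>I. a mod 3 = i \<and> b mod 3 = j \<and> c mod 3 = (1 - i - j) mod 3)"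
    unfolding mod_iff using I by blast
  also have "\<dots> \<longleftrightarrow> (\<exists>i\<in>I. \<exists>j\<in>I. p \<in> hex_class i \<times> hex_class j \<times> hex_class ((1 - i - j) mod 3))"
    by (simp only: 1 hex_class_def a_def b_def c_def mem_Sigma_iff mem_Collect_eq prod.case)
  finally show ?thesis unfolding I_def .
qed

text \<open>
  With the class of 2 counted as the class of 1, the nine products have residues (1, 0, 0) and
  (0, 2, 2) and (1, 1, 2) up to order, three of each kind.
\<close>

lemma hex_triple_theta_sum_one:
  assumes "Im \<tau> > 0"
  defines "A \<equiv> hex_theta \<tau> (hex_class 0)" and "C \<equiv> hex_theta \<tau> (hex_class 1)"
  shows "hex_triple_theta \<tau> hex_sum_one = 3 * C * (A^2 + A * C + C^2)"
proof -
  define I where "I = {0, 1, 2 :: int}"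
  let ?B = "\<lambda>(i, j). hex_class i \<times> hex_class j \<times> hex_class ((1 - i - j) mod 3)"
  have "hex_sum_one = (\<Union>p\<in>I \<times> I. ?B p)"
    by (auto simp: hex_sum_one_iff[folded I_def], blast)
  hence "hex_triple_theta \<tau> hex_sum_one = infsum (hex_triple_term \<tau>) (\<Union>p\<in>I \<times> I. ?B p)"
    by (simp only: hex_triple_theta_def)
  also have "\<dots> = (\<Sum>p\<in>I \<times> I. hex_triple_theta \<tau> (?B p))"
    unfolding hex_triple_theta_def
  proof (rule sum_infsum [symmetric])
    show "?B p \<inter> ?B q = {}" if "p \<noteq> q" for p q
      using that by (auto simp: hex_class_def)
  qed (auto simp: I_def intro: hex_triple_term_summable[OF assms(1)])
  also have "\<dots> = (\<Sum>i\<in>I. \<Sum>j\<in>I. hex_theta \<tau> (hex_class i) *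
      hex_theta \<tau> (hex_class j) * hex_theta \<tau> (hex_class ((1 - i - j) mod 3)))"
    by (simp only: sum.cartesian_product split_def hex_triple_theta_times[OF assms(1)])
  also have "\<dots> = 3 * C * (A^2 + A * C + C^2)"
    by (simp add: I_def hex_theta_class_2 A_def [symmetric] C_def [symmetric] power2_eq_square algebra_simps)
  finally show ?thesis .
qed

lemma hex_unit_triples_iff:
  "((x1, x2), (y1, y2), (z1, z2)) \<in> hex_unit_triples i \<longleftrightarrow>
     (x1 - x2) mod 3 = 1 \<and> (y1 - y2) mod 3 = 1 \<and> (z1 - z2) mod 3 = 1 \<and> (x1 + y1 + z1) mod 3 = i"
  by (simp only: hex_unit_triples_def mem_Collect_eq prod.case)

text \<open>
  Multiplying the last component by $\omega$ preserves its norm and its class modulo $1 - \omega$.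
  As $\omega - 1$ times an element congruent to 1 modulo $1 - \omega$ is congruent to $\omega - 1$
  modulo three, the residue of the sum changes always by the same amount.
\<close>

lemma hex_triple_theta_rotate:
  assumes "0 \<le> i" "i < 2"
  shows "hex_triple_theta \<tau> (hex_unit_triples (i + 1)) = hex_triple_theta \<tau> (hex_unit_triples i)"
  unfolding hex_triple_theta_def
proof (rule infsum_reindex_bij_witness[where
    j = "\<lambda>(x, y, (z1, z2)). (x, y, (z2, - z1 - z2))" and
    i = "\<lambda>(x, y, (z1, z2)). (x, y, (- z1 - z2, z1))"])
  fix p assume "p \<in> hex_unit_triples (i + 1)"
  obtain x1 x2 y1 y2 z1 z2 where p: "p = ((x1, x2), (y1, y2), (z1, z2))"
    by (rule hex_triple_cases)
  from \<open>p \<in> hex_unit_triples (i + 1)\<close> have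
    xy: "(x1 - x2) mod 3 = 1" "(y1 - y2) mod 3 = 1"
    and z: "(z1 - z2) mod 3 = 1" and s: "(x1 + y1 + z1) mod 3 = i + 1"
    unfolding p hex_unit_triples_iff by simp_all
  from z obtain k where k: "z1 - z2 = 3 * k + 1" by (rule mod_3_eqE)
  from s obtain l where l: "x1 + y1 + z1 = 3 * l + (i + 1)" by (rule mod_3_eqE)
  have "(z2 - (- z1 - z2)) mod 3 = 1"
    by (rule mod_3_eqI[of _ "z2 + k"]) (use k in arith)+
  moreover have "(x1 + y1 + z2) mod 3 = i"
    by (rule mod_3_eqI[of _ "l - k"]) (use k l assms in arith)+
  ultimately show "(\<lambda>(x, y, (z1, z2)). (x, y, (z2, - z1 - z2))) p \<in> hex_unit_triples i"
    using xy by (simp only: p prod.case hex_unit_triples_iff simp_thms)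
  show "hex_triple_term \<tau> ((\<lambda>(x, y, (z1, z2)). (x, y, (z2, - z1 - z2))) p) = hex_triple_term \<tau> p"
  proof -
    have "hex_norm (z2, - z1 - z2) = hex_norm (z1, z2)"
      by (simp add: hex_norm_def power2_eq_square algebra_simps)
    thus ?thesis by (simp only: p prod.case hex_triple_term_eq)
  qed
next
  fix p assume "p \<in> hex_unit_triples i"
  obtain x1 x2 y1 y2 z1 z2 where p: "p = ((x1, x2), (y1, y2), (z1, z2))"
    by (rule hex_triple_cases)
  from \<open>p \<in> hex_unit_triples i\<close> have
    xy: "(x1 - x2) mod 3 = 1" "(y1 - y2) mod 3 = 1"
    and z: "(z1 - z2) mod 3 = 1" and s: "(x1 + y1 + z1) mod 3 = i"
    unfolding p hex_unit_triples_iff by simp_all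
  from z obtain k where k: "z1 - z2 = 3 * k + 1" by (rule mod_3_eqE)
  from s obtain l where l: "x1 + y1 + z1 = 3 * l + i" by (rule mod_3_eqE)
  have "(- z1 - z2 - z1) mod 3 = 1"
    by (rule mod_3_eqI[of _ "k - z1"]) (use k in arith)+
  moreover have "(x1 + y1 + (- z1 - z2)) mod 3 = i + 1"
    by (rule mod_3_eqI[of _ "l - z1 + k"]) (use k l assms in arith)+
  ultimately show "(\<lambda>(x, y, (z1, z2)). (x, y, (- z1 - z2, z1))) p \<in> hex_unit_triples (i + 1)"
    using xy by (simp only: p prod.case hex_unit_triples_iff simp_thms)
qed auto

lemma hex_theta_class_1_cubed:
  assumes "Im \<tau> > 0"
  shows "hex_theta \<tau> (hex_class 1) ^ 3 = 3 * hex_triple_theta \<tau> (hex_unit_triples 0)"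
proof -
  have "hex_class 1 \<times> hex_class 1 \<times> hex_class 1 = (\<Union>i\<in>{0, 1, 2}. hex_unit_triples i)"
    using int_mod_3_cases by (auto simp: hex_class_def hex_unit_triples_def)
  hence "hex_theta \<tau> (hex_class 1) ^ 3 = infsum (hex_triple_term \<tau>) (\<Union>i\<in>{0, 1, 2}. hex_unit_triples i)"
    using hex_triple_theta_times[OF assms, of "hex_class 1" "hex_class 1" "hex_class 1"]
    by (simp add: hex_triple_theta_def power3_eq_cube)
  also have "\<dots> = (\<Sum>i\<in>{0, 1, 2}. hex_triple_theta \<tau> (hex_unit_triples i))"
    unfolding hex_triple_theta_def
    by (rule sum_infsum [symmetric])
       (use hex_triple_term_summable[OF assms] in \<open>auto simp: hex_unit_triples_def\<close>)
  also have "\<dots> = 3 * hex_triple_theta \<tau> (hex_unit_triples 0)"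
    using hex_triple_theta_rotate[of 0 \<tau>] hex_triple_theta_rotate[of 1 \<tau>] by simp
  finally show ?thesis .
qed

text \<open>
  The discrete Fourier transform over $Z[\omega]$. Modulo $1 - \omega$ all three values are
  congruent to $x + y + z$, and their sum is $3x$; this is why the image consists of triples in
  \<open>hex_unit_triples 0\<close>. Conversely the inverse transform involves a division by three, which
  these congruences make possible.
\<close>

lemma hex_triple_theta_fourier:
  "hex_triple_theta \<tau> (hex_unit_triples 0) = hex_triple_theta (3 * \<tau>) hex_sum_one"
proof -
  define j :: "hex_triple \<Rightarrow> hex_triple" where
    "j = (\<lambda>((x1, x2), (y1, y2), (z1, z2)).
       ((x1 + y1 + z1, x2 + y2 + z2),
        (x1 + y2 - z1 - z2, x2 - y1 - y2 + z1),
        (x1 - y1 - y2 + z2, x2 + y1 - z1 - z2)))"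
  have inj: "inj_on j hex_sum_one"
    by (auto simp: j_def inj_on_def)
  have img: "hex_unit_triples 0 = j ` hex_sum_one"
  proof (intro equalityI subsetI)
    fix p assume "p \<in> hex_unit_triples 0"
    obtain u1 u2 v1 v2 w1 w2 where p: "p = ((u1, u2), (v1, v2), (w1, w2))"
      by (rule hex_triple_cases)
    from \<open>p \<in> hex_unit_triples 0\<close> have
      uvw: "(u1 - u2) mod 3 = 1" "(v1 - v2) mod 3 = 1" "(w1 - w2) mod 3 = 1"
      and s: "(u1 + v1 + w1) mod 3 = 0"
      unfolding p hex_unit_triples_iff by simp_all
    from uvw(1) obtain k where "u1 - u2 = 3 * k + 1" by (rule mod_3_eqE)
    moreover from uvw(2) obtain l where "v1 - v2 = 3 * l + 1" by (rule mod_3_eqE)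
    moreover from uvw(3) obtain m where "w1 - w2 = 3 * m + 1" by (rule mod_3_eqE)
    moreover from s obtain n where "u1 + v1 + w1 = 3 * n + 0" by (rule mod_3_eqE)
    ultimately have u2: "u2 = u1 - 3 * k - 1" and v2: "v2 = v1 - 3 * l - 1" and w2: "w2 = w1 - 3 * m - 1"
      and u1: "u1 = 3 * n - v1 - w1"
      by auto
    (* The inverse Fourier transform of p, with the division by three carried out. *)
    define t :: hex_triple where
      "t = ((n, n - 1 - k - l - m), (n - v1 + l - m, n - w1 - k + m), (n - w1 - l + m, n - v1 - k + l))"
    have "p = j t" by (simp add: p t_def j_def u2 v2 w2 u1)
    moreover have "t \<in> hex_sum_one"
      unfolding t_def hex_sum_one_def mem_Collect_eq prod.case
      by (rule mod_3_eqI[of _ "k"]) (use u1 in linarith)+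
    ultimately show "p \<in> j ` hex_sum_one" by blast
  next
    fix p assume "p \<in> j ` hex_sum_one"
    then obtain x1 x2 y1 y2 z1 z2 where p: "p = j ((x1, x2), (y1, y2), (z1, z2))"
      and s: "(x1 + y1 + z1 - (x2 + y2 + z2)) mod 3 = 1"
      by (auto simp: hex_sum_one_def)
    obtain k where k: "x1 + y1 + z1 - (x2 + y2 + z2) = 3 * k + 1"
      using s by (rule mod_3_eqE)
    have "(x1 + y2 - z1 - z2 - (x2 - y1 - y2 + z1)) mod 3 = 1"
      by (rule mod_3_eqI[of _ "k + y2 - z1"]) (use k in arith)+
    moreover have "(x1 - y1 - y2 + z2 - (x2 + y1 - z1 - z2)) mod 3 = 1"
      by (rule mod_3_eqI[of _ "k - y1 + z2"]) (use k in arith)+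
    moreover have "(x1 + y1 + z1 + (x1 + y2 - z1 - z2) + (x1 - y1 - y2 + z2)) mod 3 = 0"
      by (rule mod_3_eqI[of _ x1]) auto
    ultimately show "p \<in> hex_unit_triples 0"
      using s by (simp only: p j_def prod.case hex_unit_triples_iff simp_thms)
  qed
  have "hex_triple_term \<tau> (j p) = hex_triple_term (3 * \<tau>) p" for p
  proof -
    obtain x1 x2 y1 y2 z1 z2 where p: "p = ((x1, x2), (y1, y2), (z1, z2))"
      by (rule hex_triple_cases)
    have norm: "hex_norm (x1 + y1 + z1, x2 + y2 + z2) +
        hex_norm (x1 + y2 - z1 - z2, x2 - y1 - y2 + z1) +
        hex_norm (x1 - y1 - y2 + z2, x2 + y1 - z1 - z2) =
        3 * (hex_norm (x1, x2) + hex_norm (y1, y2) + hex_norm (z1, z2))"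
      by (simp add: hex_norm_def power2_eq_square algebra_simps)
    show ?thesis
      unfolding p j_def prod.case hex_triple_term_eq norm by (simp add: mult_ac)
  qed
  thus ?thesis
    unfolding img hex_triple_theta_def by (simp add: infsum_reindex[OF inj] o_def)
qed

text \<open>
  The Borweins' cubic identity $a^3 = b^3 + c^3$: the two terms on the right are $a(q)^3$ and
  $b(q)^3$, where $b(q) = a(q^3) - c(q^3)$.
\<close>

lemma borwein_c_cubed:
  assumes "Im \<tau> > 0"
  defines "A \<equiv> hex_theta \<tau> (hex_class 0)" and "C \<equiv> hex_theta \<tau> (hex_class 1)"
  shows "borwein_c \<tau> ^ 3 = (A + 2 * C) ^ 3 - (A - C) ^ 3"
proof -
  have "borwein_c \<tau> = hex_theta (\<tau> / 3) (hex_class 1)"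
    using borwein_c_triple[of "\<tau> / 3"] by simp
  hence "borwein_c \<tau> ^ 3 = 3 * hex_triple_theta (\<tau> / 3) (hex_unit_triples 0)"
    using assms(1) by (simp add: hex_theta_class_1_cubed)
  also have "\<dots> = 3 * hex_triple_theta \<tau> hex_sum_one"
    by (simp add: hex_triple_theta_fourier)
  also have "\<dots> = 9 * C * (A^2 + A * C + C^2)"
    using assms(1) by (simp add: hex_triple_theta_sum_one A_def C_def)
  also have "\<dots> = (A + 2 * C) ^ 3 - (A - C) ^ 3"
    by (simp add: power2_eq_square power3_eq_cube algebra_simps)
  finally show ?thesis .
qed

section \<open>Trisection of a convergent series\<close>

definition cube_root_unity :: complex where
  "cube_root_unity = cis (2 * pi / 3)"

lemma cube_root_unity_sum: "1 + cube_root_unity + cube_root_unity ^ 2 = 0"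
  by (simp add: cube_root_unity_def complex_eq_iff power2_eq_square cos_120 sin_120)

lemma cube_root_unity_cubed: "cube_root_unity ^ 3 = 1"
  unfolding cube_root_unity_def Complex.DeMoivre by simp

lemma sum_cube_root_unity_powers:
  "(\<Sum>j<3. cube_root_unity ^ (j * N)) = (if 3 dvd N then 3 else 0)"
proof -
  let ?w = cube_root_unity
  have eq: "?w ^ (j * N) = (?w ^ (N mod 3)) ^ j" for j
  proof -
    have "?w ^ N = ?w ^ (3 * (N div 3) + N mod 3)" by simp
    also have "\<dots> = ?w ^ (N mod 3)"
      by (simp only: power_add power_mult cube_root_unity_cubed power_one mult_1_left)
    finally have "(?w ^ N) ^ j = (?w ^ (N mod 3)) ^ j" by (rule arg_cong)
    thus ?thesis by (simp only: power_mult [symmetric] mult.commute)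
  qed
  have "{..<3} = {0, 1, 2 :: nat}" by auto
  hence "(\<Sum>j<3. ?w ^ (j * N)) = 1 + ?w ^ (N mod 3) + (?w ^ (N mod 3)) ^ 2"
    by (simp only: eq) simp
  moreover have "N mod 3 = 0 \<or> N mod 3 = 1 \<or> N mod 3 = 2" by auto
  moreover have "(?w ^ 2) ^ 2 = ?w"
  proof -
    have "(?w ^ 2) ^ 2 = ?w ^ 3 * ?w" by (simp add: power2_eq_square power3_eq_cube mult.assoc)
    thus ?thesis by (simp add: cube_root_unity_cubed)
  qed
  ultimately have "(\<Sum>j<3. ?w ^ (j * N)) =
      (if N mod 3 = 0 then 3 else 1 + ?w + ?w ^ 2)"
    by (elim disjE) (simp_all add: add_ac)
  thus ?thesis by (simp add: cube_root_unity_sum dvd_eq_mod_eq_0)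
qed

text \<open>
  If twisting the terms \<open>u n\<close> of a convergent series by the three characters of the residues modulo
  three has the same effect as twisting a finite sum of terms \<open>g r\<close>, then orthogonality of the
  characters matches the subseries in each residue class with the corresponding part of the sum.
\<close>

lemma sums_trisection:
  fixes u g :: "nat \<Rightarrow> complex"
  assumes "m < 3" and fin_R: "finite R"
    and sums: "\<And>j. j < 3 \<Longrightarrow>
      (\<lambda>n. u n * cube_root_unity ^ (j * n)) sums (\<Sum>r\<in>R. g r * cube_root_unity ^ (j * r))"
  shows "(\<lambda>n. u (3 * n + m)) sums (\<Sum>r | r \<in> R \<and> r mod 3 = m. g r)"
proof -
  let ?w = cube_root_unity
  \<comment> \<open>The exponent \<open>2 * m\<close> stands for \<open>- m\<close>, as \<open>cube_root_unity\<close> has order three.\<close>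
  have filter: "(\<Sum>j<3. ?w ^ (j * (2 * m)) * (x * ?w ^ (j * n))) = (if n mod 3 = m then 3 * x else 0)"
    for x n
  proof -
    have "(\<Sum>j<3. ?w ^ (j * (2 * m)) * (x * ?w ^ (j * n))) = x * (\<Sum>j<3. ?w ^ (j * (2 * m + n)))"
      unfolding sum_distrib_left
      by (intro sum.cong refl) (simp only: distrib_left power_add mult_ac)
    moreover have "3 dvd (2 * m + n) \<longleftrightarrow> n mod 3 = m"
    proof -
      have "m = 0 \<or> m = 1 \<or> m = 2" using \<open>m < 3\<close> by auto
      thus ?thesis by (elim disjE) (simp, presburger+)
    qed
    ultimately show ?thesis by (simp add: sum_cube_root_unity_powers)
  qed
  have fin: "(\<Sum>r\<in>R. if r mod 3 = m then 3 * g r else 0) = 3 * (\<Sum>r | r \<in> R \<and> r mod 3 = m. g r)"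
    by (auto simp: sum.inter_filter[OF fin_R] sum_distrib_left intro!: sum.cong)
  have "(\<lambda>n. \<Sum>j<3. ?w ^ (j * (2 * m)) * (u n * ?w ^ (j * n))) sums
        (\<Sum>j<3. ?w ^ (j * (2 * m)) * (\<Sum>r\<in>R. g r * ?w ^ (j * r)))"
    using sums by (intro sums_sum sums_mult) auto
  also have "(\<Sum>j<3. ?w ^ (j * (2 * m)) * (\<Sum>r\<in>R. g r * ?w ^ (j * r))) =
        (\<Sum>r\<in>R. \<Sum>j<3. ?w ^ (j * (2 * m)) * (g r * ?w ^ (j * r)))"
    by (subst sum.swap) (simp only: sum_distrib_left)
  finally have "(\<lambda>n. if n mod 3 = m then 3 * u n else 0) sums
        (3 * (\<Sum>r | r \<in> R \<and> r mod 3 = m. g r))"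
    by (simp only: filter fin)
  also have "?this \<longleftrightarrow> (\<lambda>n. if (3 * n + m) mod 3 = m then 3 * u (3 * n + m) else 0) sums
        (3 * (\<Sum>r | r \<in> R \<and> r mod 3 = m. g r))"
  proof (rule sums_mono_reindex [symmetric])
    show "strict_mono (\<lambda>n. 3 * n + m)" by (auto simp: strict_mono_def)
    show "(if n mod 3 = m then 3 * u n else 0) = 0" if "n \<notin> range (\<lambda>n. 3 * n + m)" for n
    proof -
      have "n mod 3 \<noteq> m"
      proof
        assume "n mod 3 = m"
        hence "n = 3 * (n div 3) + m" using mult_div_mod_eq[of 3 n] by simp
        thus False using that by blast
      qed
      thus ?thesis by simp
    qed
  qed
  finally have "(\<lambda>n. 3 * u (3 * n + m)) sums (3 * (\<Sum>r | r \<in> R \<and> r mod 3 = m. g r))"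
    using \<open>m < 3\<close> by simp
  thus ?thesis by (subst (asm) sums_mult_iff) auto
qed

section \<open>The matrix as a change of basis\<close>

lemma binomial_product_expansion:
  fixes x y :: complex
  shows "(x + 2 * y) ^ M * (y - x) ^ N =
    (\<Sum>r=0..M + N. (\<Sum>l=0..M. of_nat (M choose l) * of_nat (zbinomial N (int r - int l))
       * 2 ^ l * (-1) powi (int N + int l - int r)) * x ^ (M + N - r) * y ^ r)"
proof -
  define T where "T l r = of_nat (M choose l) * of_nat (zbinomial N (int r - int l))
       * 2 ^ l * (-1) powi (int N + int l - int r) * x ^ (M + N - r) * y ^ r" for l r
  have T_shift: "T l (i + l) = (of_nat (M choose l) * (2 * y) ^ l * x ^ (M - l)) *
      (of_nat (N choose i) * y ^ i * (-x) ^ (N - i))" if "l \<le> M" "i \<le> N" for l i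
  proof -
    have sign: "(-1 :: complex) powi (int N + int l - int (i + l)) = (-1) ^ (N - i)"
      using that by (simp add: power_int_def nat_diff_distrib' flip: of_nat_diff)
    have x: "x ^ (M + N - (i + l)) = x ^ (M - l) * x ^ (N - i)"
    proof -
      have "M + N - (i + l) = (M - l) + (N - i)" using that by simp
      thus ?thesis by (simp only: power_add)
    qed
    have binom: "zbinomial N (int (i + l) - int l) = N choose i"
      by (simp add: zbinomial_def)
    show ?thesis
      unfolding T_def sign x binom power_minus[of x] power_add power_mult_distrib
      by (simp only: mult_ac)
  qed
  have T_sum: "(\<Sum>r=0..M + N. T l r) = (\<Sum>i=0..N. T l (i + l))" if "l \<le> M" for l
  proof -
    have "(\<Sum>r=0..M + N. T l r) = (\<Sum>r=0+l..N+l. T l r)"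
      by (rule sum.mono_neutral_right) (use that in \<open>auto simp: T_def zbinomial_def\<close>)
    thus ?thesis by (simp only: sum.shift_bounds_cl_nat_ivl)
  qed
  have "(x + 2 * y) ^ M * (y - x) ^ N =
      (\<Sum>l=0..M. of_nat (M choose l) * (2 * y) ^ l * x ^ (M - l)) *
      (\<Sum>i=0..N. of_nat (N choose i) * y ^ i * (-x) ^ (N - i))"
    using binomial_ring[of "2 * y" x M] binomial_ring[of y "-x" N]
    by (simp add: add.commute atMost_atLeast0)
  also have "\<dots> = (\<Sum>l=0..M. \<Sum>i=0..N. T l (i + l))"
    unfolding sum_product by (intro sum.cong refl) (simp add: T_shift)
  also have "\<dots> = (\<Sum>l=0..M. \<Sum>r=0..M + N. T l r)"
    by (rule sum.cong) (simp_all add: T_sum)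
  also have "\<dots> = (\<Sum>r=0..M + N. \<Sum>l=0..M. T l r)"
    by (rule sum.swap)
  finally show ?thesis
    by (simp only: T_def sum_distrib_right)
qed

text \<open>
  The columns of the matrix are the coordinates of the forms $(x+2y)^{3(d-k)} ((x+2y)^3-(x-y)^3)^k$
  in the monomials $x^{3d-r} y^r$. In the formula for the entries, the sum over $j$ expands the
  $k$-th power of $(y-x)^3 + (x+2y)^3$, and the sum over $l$ multiplies out a power of $x+2y$ and one
  of $y-x$.
\<close>

lemma B_mat_column_generating_function:
  fixes x y :: complex
  assumes "k \<le> d"
  shows "(\<Sum>r=0..3 * d. B_mat d $$ (r, k) * x ^ (3 * d - r) * y ^ r) =
    ((x + 2 * y) ^ 3) ^ (d - k) * ((x + 2 * y) ^ 3 - (x - y) ^ 3) ^ k"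
proof -
  define c where "c j r = (\<Sum>l=0..3 * d - 3 * j. of_nat ((3 * d - 3 * j) choose l)
       * of_nat (zbinomial (3 * j) (int r - int l))
       * 2 ^ l * (-1) powi (3 * int j + int l - int r) :: complex)" for j r
  have B: "B_mat d $$ (r, k) = (\<Sum>j=0..k. of_nat (k choose j) * c j r)" if "r \<le> 3 * d" for r
    using that assms by (simp add: B_mat_def c_def sum_distrib_left mult.assoc)
  have c: "(x + 2 * y) ^ (3 * d - 3 * j) * (y - x) ^ (3 * j) =
      (\<Sum>r=0..3 * d. c j r * x ^ (3 * d - r) * y ^ r)" if "j \<le> k" for j
    using binomial_product_expansion[of x y "3 * d - 3 * j" "3 * j"] that assms
    by (simp add: c_def)
  have "((x + 2 * y) ^ 3) ^ (d - k) * ((x + 2 * y) ^ 3 - (x - y) ^ 3) ^ k =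
      ((x + 2 * y) ^ 3) ^ (d - k) * ((y - x) ^ 3 + (x + 2 * y) ^ 3) ^ k"
    by (intro arg_cong[where f = "\<lambda>z. _ * z ^ k"]) (simp add: power3_eq_cube algebra_simps)
  also have "\<dots> = (\<Sum>j=0..k. of_nat (k choose j) *
      ((x + 2 * y) ^ (3 * d - 3 * j) * (y - x) ^ (3 * j)))"
    unfolding binomial_ring[of "(y - x) ^ 3" "(x + 2 * y) ^ 3" k] atMost_atLeast0 sum_distrib_left
  proof (rule sum.cong)
    fix j assume j: "j \<in> {0..k}"
    have "3 * d - 3 * j = 3 * (d - k) + 3 * (k - j)" using j assms by auto
    hence "(x + 2 * y) ^ (3 * d - 3 * j) = ((x + 2 * y) ^ 3) ^ (d - k) * ((x + 2 * y) ^ 3) ^ (k - j)"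
      by (simp add: power_add power_mult)
    moreover have "(y - x) ^ (3 * j) = ((y - x) ^ 3) ^ j"
      by (rule power_mult)
    ultimately show "((x + 2 * y) ^ 3) ^ (d - k) *
        (of_nat (k choose j) * ((y - x) ^ 3) ^ j * ((x + 2 * y) ^ 3) ^ (k - j)) =
        of_nat (k choose j) * ((x + 2 * y) ^ (3 * d - 3 * j) * (y - x) ^ (3 * j))"
      by (simp only: mult_ac)
  qed auto
  also have "\<dots> = (\<Sum>j=0..k. \<Sum>r=0..3 * d. of_nat (k choose j) * c j r * x ^ (3 * d - r) * y ^ r)"
    by (intro sum.cong refl) (simp add: c sum_distrib_left mult.assoc)
  also have "\<dots> = (\<Sum>r=0..3 * d. \<Sum>j=0..k. of_nat (k choose j) * c j r * x ^ (3 * d - r) * y ^ r)"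
    by (rule sum.swap)
  also have "\<dots> = (\<Sum>r=0..3 * d. B_mat d $$ (r, k) * x ^ (3 * d - r) * y ^ r)"
    by (intro sum.cong refl) (simp add: B sum_distrib_right)
  finally show ?thesis ..
qed

lemma B_mat_change_of_basis:
  fixes x y :: complex
  assumes "B_mat d *\<^sub>v Matrix.vec (d + 1) \<alpha> = Matrix.vec (3 * d + 1) \<beta>"
  shows "(\<Sum>k=0..d. \<alpha> k * ((x + 2 * y) ^ 3) ^ (d - k) * ((x + 2 * y) ^ 3 - (x - y) ^ 3) ^ k) =
         (\<Sum>r=0..3 * d. \<beta> r * x ^ (3 * d - r) * y ^ r)"
proof -
  have \<beta>: "\<beta> r = (\<Sum>k=0..d. B_mat d $$ (r, k) * \<alpha> k)" if "r \<le> 3 * d" for r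
  proof -
    have "\<beta> r = vec_index (B_mat d *\<^sub>v Matrix.vec (d + 1) \<alpha>) r"
      unfolding assms using that by simp
    also have "\<dots> = (\<Sum>k\<in>{0..<d + 1}. B_mat d $$ (r, k) * \<alpha> k)"
      using that by (simp add: B_mat_def scalar_prod_def)
    also have "{0..<d + 1} = {0..d}" by auto
    finally show ?thesis .
  qed
  have "(\<Sum>r=0..3 * d. \<beta> r * x ^ (3 * d - r) * y ^ r) =
      (\<Sum>r=0..3 * d. \<Sum>k=0..d. \<alpha> k * (B_mat d $$ (r, k) * x ^ (3 * d - r) * y ^ r))"
    by (intro sum.cong refl) (simp add: \<beta> sum_distrib_left sum_distrib_right mult_ac)
  also have "\<dots> = (\<Sum>k=0..d. \<Sum>r=0..3 * d. \<alpha> k * (B_mat d $$ (r, k) * x ^ (3 * d - r) * y ^ r))"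
    by (rule sum.swap)
  also have "\<dots> = (\<Sum>k=0..d. \<alpha> k * (((x + 2 * y) ^ 3) ^ (d - k) *
      ((x + 2 * y) ^ 3 - (x - y) ^ 3) ^ k))"
    by (intro sum.cong refl)
       (simp only: sum_distrib_left [symmetric] B_mat_column_generating_function atLeastAtMost_iff)
  finally show ?thesis by (simp add: mult.assoc)
qed

section \<open>Dissection of the expansion in a and c\<close>

lemma qpow_add: "qpow \<tau> (s + t) = qpow \<tau> s * qpow \<tau> t"
  by (simp add: qpow_def of_rat_add exp_add [symmetric] algebra_simps)

lemma exp_third: "exp (2 * of_real pi * \<i> * (of_nat j / 3) * of_nat n) = cube_root_unity ^ (j * n)"
proof -
  have "exp (2 * of_real pi * \<i> * (of_nat j / 3) * of_nat n) =
      exp (of_nat (j * n) * (\<i> * of_real (2 * pi / 3)))"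
    by (simp add: field_simps)
  thus ?thesis
    by (simp only: exp_of_nat_mult cube_root_unity_def cis_conv_exp)
qed

lemma qpow_shift: "qpow (\<tau> + of_nat j / 3) (of_nat n) = qpow \<tau> (of_nat n) * cube_root_unity ^ (j * n)"
  by (simp add: qpow_def distrib_left distrib_right exp_add mult_ac flip: exp_third)

text \<open>
  The norm of an element of the class of 0 or 1 is congruent to 0 or 1, respectively, modulo three,
  so that translating $\tau$ by \<open>j / 3\<close> multiplies all terms by the same cube root of unity.
\<close>

lemma hex_theta_shift:
  assumes "i < 2"
  shows "hex_theta (\<tau> + of_nat j / 3) (hex_class (int i)) =
         cube_root_unity ^ (j * i) * hex_theta \<tau> (hex_class (int i))"
proof -
  have "hex_term (\<tau> + of_nat j / 3) p = cube_root_unity ^ (j * i) * hex_term \<tau> p"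
    if "p \<in> hex_class (int i)" for p
  proof -
    obtain m n where p: "p = (m, n)" by force
    have "(m - n) mod 3 = int i"
      using that by (simp add: p hex_class_def)
    then obtain k where "m - n = 3 * k + int i" by (rule mod_3_eqE)
    hence m: "m = n + 3 * k + int i" by simp
    have "(int i)^2 = int i"
      using assms by (auto simp: less_2_cases_iff)
    hence "hex_norm p = 3 * (3 * k^2 + 2 * k * int i + m * n) + int i"
      by (simp add: p hex_norm_def m power2_eq_square algebra_simps)
    then obtain l where norm: "hex_norm p = 3 * l + int i" by blast
    have "hex_term (\<tau> + of_nat j / 3) p =
        hex_term \<tau> p * exp (2 * of_real pi * \<i> * (of_nat j / 3) * of_int (3 * l + int i))"
      by (simp only: hex_term_def norm distrib_left distrib_right exp_add mult_ac)
    also have "2 * of_real pi * \<i> * (of_nat j / 3) * of_int (3 * l + int i) =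
        (2 * of_int (int j * l) * of_real pi) * \<i> + 2 * of_real pi * \<i> * (of_nat j / 3) * of_nat i"
      by (simp add: field_simps)
    also have "exp \<dots> = cube_root_unity ^ (j * i)"
    proof -
      have "exp ((2 * of_int (int j * l) * of_real pi) * \<i>) = 1"
        using exp_integer_2pi[of "of_int (int j * l)"] by (simp add: mult_ac)
      thus ?thesis by (simp only: exp_add exp_third mult_1_left)
    qed
    finally show ?thesis by (simp only: mult_ac)
  qed
  hence "hex_theta (\<tau> + of_nat j / 3) (hex_class (int i)) =
      infsum (\<lambda>p. cube_root_unity ^ (j * i) * hex_term \<tau> p) (hex_class (int i))"
    unfolding hex_theta_def by (rule infsum_cong)
  thus ?thesis by (simp add: hex_theta_def infsum_cmult_right')
qed

text \<open>
  For \<open>m\<close> equal to 1 or 2, the index \<open>3 * d + m\<close> exceeds \<open>3 * d\<close>, so that the last \<open>k\<close> is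
  \<open>d - 1\<close>.
\<close>

lemma residue_class_upto:
  assumes "d > 0" "m < 3"
  shows "{r. r \<in> {0..3 * d} \<and> r mod 3 = m} = (\<lambda>k. 3 * k + m) ` {0..d - principal_char3 m}"
proof (intro equalityI subsetI)
  have "3 dvd m \<longleftrightarrow> m = 0"
    using assms(2) by (auto dest: dvd_imp_le)
  hence char: "principal_char3 m = (if m = 0 then 0 else 1)"
    by (simp add: principal_char3_def)
  fix r
  show "r \<in> (\<lambda>k. 3 * k + m) ` {0..d - principal_char3 m}"
    if r: "r \<in> {r. r \<in> {0..3 * d} \<and> r mod 3 = m}"
  proof -
    have "r = 3 * (r div 3) + m"
      using r mult_div_mod_eq[of 3 r] by simp
    then obtain k where k: "r = 3 * k + m" by blast
    with r have "3 * k + m \<le> 3 * d" by simp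
    hence "k \<le> d - principal_char3 m" by (auto simp: char)
    thus ?thesis using k by auto
  qed
  show "r \<in> {r. r \<in> {0..3 * d} \<and> r mod 3 = m}"
    if "r \<in> (\<lambda>k. 3 * k + m) ` {0..d - principal_char3 m}"
    using that assms by (auto simp: char split: if_splits)
qed

lemma borwein_expansion_eq:
  assumes "Im \<tau> > 0"
    and "B_mat d *\<^sub>v Matrix.vec (d + 1) \<alpha> = Matrix.vec (3 * d + 1) \<beta>"
  shows "(\<Sum>k=0..d. \<alpha> k * borwein_a \<tau> ^ (3 * (d - k)) * borwein_c \<tau> ^ (3 * k)) =
         (\<Sum>r=0..3 * d. \<beta> r * hex_theta \<tau> (hex_class 0) ^ (3 * d - r) * hex_theta \<tau> (hex_class 1) ^ r)"
  using B_mat_change_of_basis[OF assms(2)]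
  by (simp only: power_mult borwein_c_cubed[OF assms(1)] borwein_a_eq[OF assms(1)])

theorem theorem3p2:
  fixes d :: nat and f :: "complex \<Rightarrow> complex" and v \<alpha> \<beta> :: "nat \<Rightarrow> complex"
  assumes "d > 0"
    and "f \<in> homog_span d (\<lambda>\<tau>. borwein_a \<tau> ^ 3) (\<lambda>\<tau>. borwein_c \<tau> ^ 3)"
    and "has_q_expansion f v"
    and "\<And>\<tau>. Im \<tau> > 0 \<Longrightarrow>
           f \<tau> = (\<Sum>k=0..d. \<alpha> k * borwein_a \<tau> ^ (3 * (d - k)) * borwein_c \<tau> ^ (3 * k))"
    and "B_mat d *\<^sub>v Matrix.vec (d + 1) \<alpha> = Matrix.vec (3 * d + 1) \<beta>"
  shows "\<forall>m\<in>{0, 1, 2}. \<forall>\<tau>. Im \<tau> > 0 \<longrightarrow>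
           dissect3 m f \<tau> = (\<Sum>n. v (3 * n + m) * qpow \<tau> (of_nat n)) \<and>
           (\<lambda>n. v (3 * n + m) * qpow \<tau> (of_nat n)) sums
             (qpow \<tau> (- (of_nat m / 3)) *
              (\<Sum>k=0..d - principal_char3 m. \<beta> (3 * k + m) *
                 borwein_a \<tau> ^ (3 * d - 3 * k - m) * borwein_c \<tau> ^ (3 * k + m)))"
proof (intro ballI allI impI conjI)
  fix m :: nat and \<tau> :: complex
  assume "m \<in> {0, 1, 2}" and \<tau>: "Im \<tau> > 0"
  hence m: "m < 3" by auto
  show "dissect3 m f \<tau> = (\<Sum>n. v (3 * n + m) * qpow \<tau> (of_nat n))"
    by (simp add: dissect3_def q_coeffs_eq[OF assms(3)])
  define \<sigma> where "\<sigma> = \<tau> / 3"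
  define g where "g r = \<beta> r * borwein_a \<tau> ^ (3 * d - r) * borwein_c \<tau> ^ r" for r
  have a: "borwein_a \<tau> = hex_theta \<sigma> (hex_class 0)"
    and c: "borwein_c \<tau> = hex_theta \<sigma> (hex_class 1)"
    using borwein_a_triple[of \<sigma>] borwein_c_triple[of \<sigma>] by (simp_all add: \<sigma>_def)
  have "(\<lambda>n. v n * qpow \<sigma> (of_nat n) * cube_root_unity ^ (j * n)) sums
      (\<Sum>r\<in>{0..3 * d}. g r * cube_root_unity ^ (j * r))" for j
  proof -
    have Im: "Im (\<sigma> + of_nat j / 3) > 0"
      using \<tau> by (simp add: \<sigma>_def)
    have "f (\<sigma> + of_nat j / 3) =
        (\<Sum>r=0..3 * d. \<beta> r * hex_theta (\<sigma> + of_nat j / 3) (hex_class 0) ^ (3 * d - r) *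
           hex_theta (\<sigma> + of_nat j / 3) (hex_class 1) ^ r)"
      by (simp only: assms(4)[OF Im] borwein_expansion_eq[OF Im assms(5)])
    also have "\<dots> = (\<Sum>r=0..3 * d. g r * cube_root_unity ^ (j * r))"
    proof (intro sum.cong refl)
      fix r
      have "hex_theta (\<sigma> + of_nat j / 3) (hex_class 0) = borwein_a \<tau>"
        "hex_theta (\<sigma> + of_nat j / 3) (hex_class 1) = cube_root_unity ^ j * borwein_c \<tau>"
        using hex_theta_shift[of 0 \<sigma> j] hex_theta_shift[of 1 \<sigma> j] by (simp_all add: a c)
      thus "\<beta> r * hex_theta (\<sigma> + of_nat j / 3) (hex_class 0) ^ (3 * d - r) *
           hex_theta (\<sigma> + of_nat j / 3) (hex_class 1) ^ r = g r * cube_root_unity ^ (j * r)"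
        by (simp only: g_def power_mult_distrib power_mult mult_ac)
    qed
    finally have f: "f (\<sigma> + of_nat j / 3) = (\<Sum>r\<in>{0..3 * d}. g r * cube_root_unity ^ (j * r))" .
    have "(\<lambda>n. v n * qpow (\<sigma> + of_nat j / 3) (of_nat n)) sums f (\<sigma> + of_nat j / 3)"
      using assms(3) Im unfolding has_q_expansion_def by blast
    thus ?thesis by (simp only: f qpow_shift mult.assoc)
  qed
  hence "(\<lambda>n. v (3 * n + m) * qpow \<sigma> (of_nat (3 * n + m))) sums
      (\<Sum>r | r \<in> {0..3 * d} \<and> r mod 3 = m. g r)"
    by (intro sums_trisection m) auto
  also have "(\<Sum>r | r \<in> {0..3 * d} \<and> r mod 3 = m. g r) = (\<Sum>k=0..d - principal_char3 m. g (3 * k + m))"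
    unfolding residue_class_upto[OF assms(1) m] by (subst sum.reindex) (auto simp: inj_on_def)
  finally have sums: "(\<lambda>n. qpow \<tau> (- (of_nat m / 3)) * (v (3 * n + m) * qpow \<sigma> (of_nat (3 * n + m)))) sums
      (qpow \<tau> (- (of_nat m / 3)) * (\<Sum>k=0..d - principal_char3 m. g (3 * k + m)))"
    by (rule sums_mult)
  have eq: "qpow \<tau> (- (of_nat m / 3)) * (v (3 * n + m) * qpow \<sigma> (of_nat (3 * n + m))) =
      v (3 * n + m) * qpow \<tau> (of_nat n)" for n
  proof -
    have "qpow \<sigma> (of_nat N) = qpow \<tau> (of_nat N / 3)" for N
      by (simp add: qpow_def \<sigma>_def of_rat_divide)
    hence "qpow \<tau> (- (of_nat m / 3)) * qpow \<sigma> (of_nat (3 * n + m)) =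
        qpow \<tau> (- (of_nat m / 3) + of_nat (3 * n + m) / 3)"
      by (simp only: qpow_add)
    also have "- (of_nat m / 3) + of_nat (3 * n + m) / 3 = (of_nat n :: rat)"
      by (simp add: field_simps)
    finally show ?thesis by (simp only: mult.left_commute)
  qed
  show "(\<lambda>n. v (3 * n + m) * qpow \<tau> (of_nat n)) sums
             (qpow \<tau> (- (of_nat m / 3)) *
              (\<Sum>k=0..d - principal_char3 m. \<beta> (3 * k + m) *
                 borwein_a \<tau> ^ (3 * d - 3 * k - m) * borwein_c \<tau> ^ (3 * k + m)))"
    using sums by (simp only: eq g_def diff_diff_left)
qed

end
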